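(* Let $G_w$ be a weighted bicyclic graph. Then the rank of $A(G_w)$ equals $3$ if and only if $G_w$ is (isomorphic as a weighted graph to) $\theta(1,0,1)_w$ with weights satisfying $a_2c_1=a_1c_2$.
   Context: A weighted graph $G_w$ is a simple graph with a positive weight on each edge; its adjacency matrix $A(G_w)$ has entry $w(xy)$ if $xy$ is an edge and $0$ otherwise. A bicyclic graph is a connected simple graph with $|E|=|V|+1$. $\theta(1,0,1)_w$ is the weighted graph with vertices $u,v,x_1,z_1$ and edges $ux_1,x_1v,uv,uz_1,z_1v$ with positive weights $w(ux_1)=a_1$, $w(x_1v)=a_2$, $w(uv)=b_1$, $w(uz_1)=c_1$, $w(z_1v)=c_2$. *)

theory Defs
  imports "HOL-Analysis.Analysis"
begin

text \<open>
  The vertex set is the whole type \<open>'a\<close>, which is required to be finite where the adjacency matrix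
  is formed. Edges are unordered pairs; values of the weight off the edge set carry no meaning.
\<close>

record 'a wgraph =
  edges :: "'a set set"
  weight :: "'a set \<Rightarrow> real"

definition weighted_graph :: "'a wgraph \<Rightarrow> bool" where
  "weighted_graph G \<longleftrightarrow> (\<forall>e\<in>edges G. card e = 2 \<and> weight G e > 0)"

definition connected_graph :: "'a wgraph \<Rightarrow> bool" where
  "connected_graph G \<longleftrightarrow> (\<forall>x y. (x, y) \<in> {(p, q). {p, q} \<in> edges G}\<^sup>*)"

definition bicyclic :: "('a::finite) wgraph \<Rightarrow> bool" where
  "bicyclic G \<longleftrightarrow> connected_graph G \<and> card (edges G) = CARD('a) + 1"

definition adjacency_matrix :: "('a::finite) wgraph \<Rightarrow> real^'a^'a" where
  "adjacency_matrix G = (\<chi> x y. if {x, y} \<in> edges G then weight G {x, y} else 0)"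

definition wgraph_iso :: "'a wgraph \<Rightarrow> 'b wgraph \<Rightarrow> bool" where
  "wgraph_iso G H \<longleftrightarrow>
    (\<exists>f. bij f \<and>
      (\<forall>x y. {x, y} \<in> edges G \<longleftrightarrow> {f x, f y} \<in> edges H) \<and>
      (\<forall>x y. {x, y} \<in> edges G \<longrightarrow> weight G {x, y} = weight H {f x, f y}))"

datatype theta_vertex = U | V | X1 | Z1

definition theta101 :: "real \<Rightarrow> real \<Rightarrow> real \<Rightarrow> real \<Rightarrow> real \<Rightarrow> theta_vertex wgraph" where
  "theta101 a1 a2 b1 c1 c2 =
    \<lparr>edges = {{U, X1}, {X1, V}, {U, V}, {U, Z1}, {Z1, V}},
     weight = (\<lambda>e. if e = {U, X1} then a1
                   else if e = {X1, V} then a2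
                   else if e = {U, V} then b1
                   else if e = {U, Z1} then c1
                   else if e = {Z1, V} then c2
                   else 0)\<rparr>"

end

theory Submission
  imports Defs
begin

text \<open>
  Three rows \<open>p\<close>, \<open>q\<close>, \<open>r\<close> forming a basis of the row space of a symmetric matrix give a nonsingular
  principal submatrix; with a zero diagonal this means that \<open>p\<close>, \<open>q\<close>, \<open>r\<close> span a triangle.
  A further vertex adjacent to at most one vertex of the triangle would be isolated, so every
  further vertex contributes at least two edges. On \<open>n\<close> vertices this gives \<open>n + 1 \<ge> 3 + 2 (n - 3)\<close>, which leaves the
  complete graph on four vertices minus one edge, and rank three forces its two nonadjacent vertices
  to have proportional rows.
\<close>

section \<open>Rank three in terms of scalar combinations of rows\<close>

text \<open>As a set, \<open>{u, v, w}\<close> collapses when vectors coincide, so set independence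
  alone would accept repetitions; the cardinality condition makes it independence of the
  triple.\<close>

lemma independent_card_3_iff:
  fixes u v w :: "'b::real_vector"
  shows "independent {u, v, w} \<and> card {u, v, w} = 3 \<longleftrightarrow>
    (\<forall>a b c. a *\<^sub>R u + b *\<^sub>R v + c *\<^sub>R w = 0 \<longrightarrow> a = 0 \<and> b = 0 \<and> c = 0)"
    (is "?L \<longleftrightarrow> ?R")
proof
  assume L: ?L
  then have d: "u \<noteq> v" "u \<noteq> w" "v \<noteq> w"
    by (auto simp: card_insert_if split: if_splits)
  show ?R
  proof (intro allI impI)
    fix a b c
    assume eq: "a *\<^sub>R u + b *\<^sub>R v + c *\<^sub>R w = 0"
    define f where "f x = (if x = u then a else if x = v then b else c)" for x
    have "(\<Sum>x\<in>{u, v, w}. f x *\<^sub>R x) = 0"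
      using d eq by (simp add: f_def add.assoc)
    then have "\<forall>x\<in>{u, v, w}. f x = 0"
      using L independentD[of "{u, v, w}" "{u, v, w}" f] by blast
    then show "a = 0 \<and> b = 0 \<and> c = 0"
      using d by (auto simp: f_def split: if_splits)
  qed
next
  assume R: ?R
  have d: "u \<noteq> v" "u \<noteq> w" "v \<noteq> w"
    \<comment> \<open>Equal vectors would satisfy a relation with coefficients 1 and -1.\<close>
    using R[rule_format, of 1 "-1" 0] R[rule_format, of 1 0 "-1"] R[rule_format, of 0 1 "-1"]
    by auto
  have "independent {u, v, w}"
  proof (rule independent_if_scalars_zero)
    fix f x
    assume "(\<Sum>x\<in>{u, v, w}. f x *\<^sub>R x) = 0" "x \<in> {u, v, w}"
    then show "f x = 0"
      using R[rule_format, of "f u" "f v" "f w"] d by (auto simp: add.assoc)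
  qed simp
  then show ?L
    using d by simp
qed

text \<open>A basis of the row space can be chosen among the rows, so it is given by three indices;
  the scalar form can then be evaluated entry by entry.\<close>

lemma rank_eq_3_iff:
  fixes M :: "real^'n^'m"
  shows "rank M = 3 \<longleftrightarrow>
    (\<exists>p q r. (\<forall>a b c. a *\<^sub>R M $ p + b *\<^sub>R M $ q + c *\<^sub>R M $ r = 0 \<longrightarrow> a = 0 \<and> b = 0 \<and> c = 0) \<and>
      (\<forall>y. \<exists>a b c. M $ y = a *\<^sub>R M $ p + b *\<^sub>R M $ q + c *\<^sub>R M $ r))"
    (is "_ \<longleftrightarrow> ?R")
proof -
  have rows: "rows M = range (($) M)"
    by (auto simp: rows_def row_def)
  have span3: "y \<in> span {u, v, w} \<longleftrightarrow> (\<exists>a b c. y = a *\<^sub>R u + b *\<^sub>R v + c *\<^sub>R w)"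
    for y u v w :: "real^'n"
    by (simp add: span_breakdown_eq algebra_simps)
  show ?thesis
  proof
    assume "rank M = 3"
    then obtain B where B: "B \<subseteq> rows M" "independent B" "rows M \<subseteq> span B" "card B = 3"
      by (metis basis_exists row_rank_def)
    then obtain u v w where uvw: "B = {u, v, w}"
      by (metis card_3_iff)
    with B(1) obtain p q r where pqr: "u = M $ p" "v = M $ q" "w = M $ r"
      by (auto simp: rows)
    have "\<forall>y. \<exists>a b c. M $ y = a *\<^sub>R M $ p + b *\<^sub>R M $ q + c *\<^sub>R M $ r"
      using B(3) unfolding rows uvw pqr by (auto simp flip: span3)
    moreover have "\<forall>a b c. a *\<^sub>R M $ p + b *\<^sub>R M $ q + c *\<^sub>R M $ r = 0 \<longrightarrow> a = 0 \<and> b = 0 \<and> c = 0"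
      using B(2,4) unfolding uvw pqr independent_card_3_iff[symmetric] by blast
    ultimately show ?R
      by blast
  next
    assume ?R
    then obtain p q r where
      ind: "independent {M $ p, M $ q, M $ r}" "card {M $ p, M $ q, M $ r} = 3" and
      span: "\<And>y. M $ y \<in> span {M $ p, M $ q, M $ r}"
      unfolding span3 independent_card_3_iff[symmetric] by blast
    have "dim (rows M) = card {M $ p, M $ q, M $ r}"
      by (rule dim_unique) (use ind span in \<open>auto simp: rows\<close>)
    then show "rank M = 3"
      using ind by (simp add: row_rank_def)
  qed
qed

section \<open>Symmetric matrices with zero diagonal spanned by three rows\<close>

text \<open>Independence of the three rows enters later, as a hypothesis of
  \<open>entry_neq_0\<close> or through nonzero entries on the triangle.\<close>

locale three_row_basis =
  fixes A :: "real^'a^'a" and p q r :: 'a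
  assumes sym: "A $ x $ y = A $ y $ x"
    and diag: "A $ x $ x = 0"
    and spanning: "\<exists>a b c. A $ x = a *\<^sub>R A $ p + b *\<^sub>R A $ q + c *\<^sub>R A $ r"
begin

text \<open>By symmetry, \<open>v $ y\<close> is a combination of entries of row \<open>y\<close>;
  expanding that row in the three spanning rows leaves a combination of \<open>v $ p\<close>,
  \<open>v $ q\<close>, \<open>v $ r\<close>. Hence these three entries determine a vector of the
  row space.\<close>

lemma row_combination_eq_0:
  assumes v: "v = a *\<^sub>R A $ p + b *\<^sub>R A $ q + c *\<^sub>R A $ r"
    and zero: "v $ p = 0" "v $ q = 0" "v $ r = 0"
  shows "v = 0"
proof -
  have "v $ y = 0" for y
  proof -
    obtain a' b' c' where y: "A $ y = a' *\<^sub>R A $ p + b' *\<^sub>R A $ q + c' *\<^sub>R A $ r"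
      using spanning by blast
    have "v $ y = a * A $ y $ p + b * A $ y $ q + c * A $ y $ r"
      by (simp add: v sym)
    also have "\<dots> = a' * v $ p + b' * v $ q + c' * v $ r"
      by (simp add: y v algebra_simps sym[of q p] sym[of r p] sym[of r q])
    finally show ?thesis
      using zero by simp
  qed
  then show ?thesis
    by (simp add: vec_eq_iff)
qed

lemma row_eq_0:
  assumes "A $ x $ p = 0" "A $ x $ q = 0" "A $ x $ r = 0"
  shows "A $ x = 0"
  using row_combination_eq_0 spanning assms by blast

text \<open>If the entry vanished, eliminating coordinate \<open>r\<close> between rows
  \<open>p\<close> and \<open>q\<close> would give a vector that is zero at all three positions.
  Independence then forces \<open>A $ p $ r = 0\<close>, so row \<open>p\<close> would be
  zero.\<close>

lemma entry_neq_0: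
  assumes ind: "\<And>a b c. a *\<^sub>R A $ p + b *\<^sub>R A $ q + c *\<^sub>R A $ r = 0 \<Longrightarrow> a = 0 \<and> b = 0 \<and> c = 0"
  shows "A $ p $ q \<noteq> 0"
proof
  assume pq: "A $ p $ q = 0"
  have "A $ q $ r *\<^sub>R A $ p + (- A $ p $ r) *\<^sub>R A $ q + 0 *\<^sub>R A $ r = 0"
    by (rule row_combination_eq_0[OF refl])
      (simp_all add: pq diag sym[of q p] sym[of r p] sym[of r q])
  then have "A $ p $ r = 0"
    using ind by fastforce
  then have "A $ p = 0"
    using row_eq_0 pq diag by blast
  then show False
    using ind[of 1 0 0] by simp
qed

text \<open>Under the negation, \<open>0 = A $ x $ x = a * A $ x $ p\<close>. If
  \<open>a = 0\<close>, the entries at \<open>q\<close> and \<open>r\<close> force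
  \<open>b = c = 0\<close>; either way \<open>A $ x $ p = 0\<close>, so row \<open>x\<close>
  vanishes. Applied to all orderings of the triangle, this gives \<open>x\<close> two neighbours in
  it.\<close>

lemma two_neighbours:
  assumes tri: "A $ p $ q \<noteq> 0" "A $ p $ r \<noteq> 0" "A $ q $ r \<noteq> 0"
    and x: "A $ x \<noteq> 0"
  shows "A $ x $ q \<noteq> 0 \<or> A $ x $ r \<noteq> 0"
proof (rule ccontr)
  assume "\<not> ?thesis"
  then have xq: "A $ x $ q = 0" and xr: "A $ x $ r = 0"
    by auto
  obtain a b c where y: "A $ x = a *\<^sub>R A $ p + b *\<^sub>R A $ q + c *\<^sub>R A $ r"
    using spanning by blast
  note entry = arg_cong[where f = "\<lambda>v. v $ _", OF y, simplified]
  have "A $ x $ x = a * A $ x $ p"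
    using entry[of x] xq xr by (simp add: sym[of p x] sym[of q x] sym[of r x])
  moreover have q: "0 = a * A $ p $ q + c * A $ q $ r" and r: "0 = a * A $ p $ r + b * A $ q $ r"
    using entry[of q] entry[of r] xq xr by (simp_all add: diag sym[of r q])
  moreover have p: "A $ x $ p = b * A $ p $ q + c * A $ p $ r"
    using entry[of p] by (simp add: diag sym[of q p] sym[of r p])
  ultimately have "A $ x $ p = 0"
    using tri diag[of x] by auto
  then show False
    using row_eq_0 xq xr x by blast
qed

text \<open>The entries of row \<open>x\<close> at \<open>r\<close> and \<open>x\<close> give two
  homogeneous equations for \<open>a\<close> and \<open>b\<close>, whose determinant vanishes
  exactly when the claim holds. Otherwise \<open>a = b = 0\<close>, so row \<open>x\<close> is a
  multiple of row \<open>r\<close>, and its entries at \<open>p\<close> and \<open>q\<close> yield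
  the claim anyway.\<close>

lemma proportional_rows:
  assumes tri: "A $ p $ q \<noteq> 0" "A $ p $ r \<noteq> 0" "A $ q $ r \<noteq> 0"
    and xr: "A $ x $ r = 0"
  shows "A $ q $ r * A $ p $ x = A $ p $ r * A $ q $ x"
proof (rule ccontr)
  assume neq: "\<not> ?thesis"
  obtain a b c where y: "A $ x = a *\<^sub>R A $ p + b *\<^sub>R A $ q + c *\<^sub>R A $ r"
    using spanning by blast
  note entry = arg_cong[where f = "\<lambda>v. v $ _", OF y, simplified]
  have r: "a * A $ p $ r + b * A $ q $ r = 0"
    using entry[of r] xr by (simp add: diag)
  have x: "a * A $ p $ x + b * A $ q $ x = 0"
    using entry[of x] xr by (simp add: diag sym[of r x])
  have "a * (A $ q $ r * A $ p $ x - A $ p $ r * A $ q $ x) = 0"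
    using r x by algebra
  then have a: "a = 0"
    using neq by simp
  then have b: "b = 0"
    using r tri by simp
  have "A $ p $ x = c * A $ p $ r" "A $ q $ x = c * A $ q $ r"
    using entry[of p] entry[of q] by (simp_all add: a b sym[of r p] sym[of r q] sym[of x p] sym[of x q])
  then show False
    using neq by simp
qed

end

text \<open>These two transpositions generate all permutations, so facts about one position in the
  triple carry over to the others.\<close>

lemma three_row_basis_swap:
  assumes "three_row_basis A p q r"
  shows "three_row_basis A q p r" "three_row_basis A p r q"
proof -
  interpret three_row_basis A p q r by fact
  have "\<exists>a b c. A $ x = a *\<^sub>R A $ q + b *\<^sub>R A $ p + c *\<^sub>R A $ r"
    "\<exists>a b c. A $ x = a *\<^sub>R A $ p + b *\<^sub>R A $ r + c *\<^sub>R A $ q" for x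
  proof -
    obtain a b c where "A $ x = a *\<^sub>R A $ p + b *\<^sub>R A $ q + c *\<^sub>R A $ r"
      using spanning by blast
    then have "A $ x = b *\<^sub>R A $ q + a *\<^sub>R A $ p + c *\<^sub>R A $ r"
      "A $ x = a *\<^sub>R A $ p + c *\<^sub>R A $ r + b *\<^sub>R A $ q"
      by simp_all
    then show "\<exists>a b c. A $ x = a *\<^sub>R A $ q + b *\<^sub>R A $ p + c *\<^sub>R A $ r"
      "\<exists>a b c. A $ x = a *\<^sub>R A $ p + b *\<^sub>R A $ r + c *\<^sub>R A $ q"
      by blast+
  qed
  then show "three_row_basis A q p r" "three_row_basis A p r q"
    by (simp_all add: three_row_basis_def sym diag)
qed

text \<open>Swaps bring each pair of indices to the first two positions, where
  \<open>entry_neq_0\<close> applies.\<close>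

lemma rank_3_triangle:
  fixes A :: "real^'a^'a"
  assumes sym: "\<And>x y. A $ x $ y = A $ y $ x" and diag: "\<And>x. A $ x $ x = 0"
    and "rank A = 3"
  obtains p q r where "three_row_basis A p q r"
    "A $ p $ q \<noteq> 0" "A $ p $ r \<noteq> 0" "A $ q $ r \<noteq> 0"
proof -
  obtain p q r where
    ind: "\<And>a b c. a *\<^sub>R A $ p + b *\<^sub>R A $ q + c *\<^sub>R A $ r = 0 \<Longrightarrow> a = 0 \<and> b = 0 \<and> c = 0" and
    span: "\<And>y. \<exists>a b c. A $ y = a *\<^sub>R A $ p + b *\<^sub>R A $ q + c *\<^sub>R A $ r"
    using \<open>rank A = 3\<close> unfolding rank_eq_3_iff by metis
  have ind_prq: "a = 0 \<and> b = 0 \<and> c = 0" if "a *\<^sub>R A $ p + b *\<^sub>R A $ r + c *\<^sub>R A $ q = 0" for a b c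
    using ind[of a c b] that by (simp add: algebra_simps)
  have ind_qrp: "a = 0 \<and> b = 0 \<and> c = 0" if "a *\<^sub>R A $ q + b *\<^sub>R A $ r + c *\<^sub>R A $ p = 0" for a b c
    using ind[of c a b] that by (simp add: algebra_simps)
  have B: "three_row_basis A p q r"
    by standard (fact sym, fact diag, fact span)
  show ?thesis
  proof
    show "three_row_basis A p q r" by fact
    show "A $ p $ q \<noteq> 0"
      by (rule three_row_basis.entry_neq_0[OF B]) (rule ind)
    show "A $ p $ r \<noteq> 0"
      by (rule three_row_basis.entry_neq_0[OF three_row_basis_swap(2)[OF B]])
        (rule ind_prq)
    show "A $ q $ r \<noteq> 0"
      by (rule three_row_basis.entry_neq_0[OF three_row_basis_swap(2)[OF three_row_basis_swap(1)[OF B]]])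
        (rule ind_qrp)
  qed
qed

text \<open>The principal submatrix on \<open>p\<close>, \<open>q\<close>, \<open>r\<close> has
  determinant \<open>2 * A $ p $ q * A $ p $ r * A $ q $ r\<close>, and the ratio condition makes
  row \<open>x\<close> a multiple of row \<open>r\<close>.\<close>

lemma rank_3_if_proportional_rows:
  fixes A :: "real^'a^'a"
  assumes sym: "\<And>x y. A $ x $ y = A $ y $ x" and diag: "\<And>x. A $ x $ x = 0"
    and univ: "UNIV = {p, q, r, x}"
    and tri: "A $ p $ q \<noteq> 0" "A $ p $ r \<noteq> 0" "A $ q $ r \<noteq> 0"
    and xr: "A $ r $ x = 0"
    and ratio: "A $ q $ r * A $ p $ x = A $ p $ r * A $ q $ x"
  shows "rank A = 3"
proof -
  have ind: "a = 0 \<and> b = 0 \<and> c = 0" if eq: "a *\<^sub>R A $ p + b *\<^sub>R A $ q + c *\<^sub>R A $ r = 0" for a b c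
  proof -
    note entry = arg_cong[where f = "\<lambda>v. v $ _", OF eq, simplified]
    have p: "b * A $ p $ q + c * A $ p $ r = 0" and q: "a * A $ p $ q + c * A $ q $ r = 0"
      and r: "a * A $ p $ r + b * A $ q $ r = 0"
      using entry[of p] entry[of q] entry[of r] by (simp_all add: diag sym[of q p] sym[of r p] sym[of r q])
    \<comment> \<open>Add \<open>A $ p $ r\<close> times equation \<open>q\<close> to
      \<open>A $ p $ q\<close> times equation \<open>r\<close>; by \<open>p\<close> the terms in
      \<open>b\<close> and \<open>c\<close> cancel.\<close>
    have "2 * a * A $ p $ q * A $ p $ r = 0"
      using p q r by algebra
    then have "a = 0"
      using tri by simp
    then show ?thesis
      using q r tri by simp
  qed
  \<comment> \<open>The factor is read off in column \<open>p\<close>; \<open>ratio\<close> gives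
    column \<open>q\<close>, and both rows vanish in columns \<open>r\<close> and
    \<open>x\<close>.\<close>
  have x: "A $ x = (A $ p $ x / A $ p $ r) *\<^sub>R A $ r"
  proof -
    have "A $ x $ y = (A $ p $ x / A $ p $ r) * A $ r $ y" for y
    proof -
      have "y \<in> {p, q, r, x}"
        using univ by blast
      then show ?thesis
        using tri xr ratio by (auto simp: diag sym[of x] sym[of r p] sym[of r q] field_simps)
    qed
    then show ?thesis
      by (simp add: vec_eq_iff)
  qed
  have span: "\<exists>a b c. A $ y = a *\<^sub>R A $ p + b *\<^sub>R A $ q + c *\<^sub>R A $ r" for y
  proof -
    have "y \<in> {p, q, r, x}"
      using univ by blast
    moreover have "A $ p = 1 *\<^sub>R A $ p + 0 *\<^sub>R A $ q + 0 *\<^sub>R A $ r"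
      "A $ q = 0 *\<^sub>R A $ p + 1 *\<^sub>R A $ q + 0 *\<^sub>R A $ r"
      "A $ r = 0 *\<^sub>R A $ p + 0 *\<^sub>R A $ q + 1 *\<^sub>R A $ r"
      "A $ x = 0 *\<^sub>R A $ p + 0 *\<^sub>R A $ q + (A $ p $ x / A $ p $ r) *\<^sub>R A $ r"
      using x by simp_all
    ultimately show ?thesis
      by blast
  qed
  show ?thesis
    unfolding rank_eq_3_iff using ind span by blast
qed

section \<open>Adjacency matrices and connectivity\<close>

lemma adjacency_matrix_nth:
  "adjacency_matrix G $ x $ y = (if {x, y} \<in> edges G then weight G {x, y} else 0)"
  by (simp add: adjacency_matrix_def)

lemma adjacency_matrix_sym: "adjacency_matrix G $ x $ y = adjacency_matrix G $ y $ x"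
  by (simp add: adjacency_matrix_nth insert_commute)

lemma adjacency_matrix_diag:
  assumes "weighted_graph G"
  shows "adjacency_matrix G $ x $ x = 0"
  using assms by (fastforce simp: adjacency_matrix_nth weighted_graph_def)

text \<open>Positivity of the weights lets the zero pattern of the matrix reveal the edges.\<close>

lemma adjacency_matrix_neq_0_iff:
  assumes "weighted_graph G"
  shows "adjacency_matrix G $ x $ y \<noteq> 0 \<longleftrightarrow> {x, y} \<in> edges G"
  using assms by (simp add: adjacency_matrix_nth weighted_graph_def) (metis less_irrefl)

text \<open>The first step of a path from \<open>x\<close> to another vertex is such an edge; this
  will exclude zero rows.\<close>

lemma connected_graph_has_neighbour:
  assumes "connected_graph G" "x \<noteq> y"
  obtains z where "{x, z} \<in> edges G"
proof -
  have "(x, y) \<in> {(p, q). {p, q} \<in> edges G}\<^sup>*"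
    using assms by (simp add: connected_graph_def)
  then show ?thesis
    using assms(2) that by (cases rule: converse_rtranclE) auto
qed

lemma weighted_graph_edgeE:
  assumes "weighted_graph G" "e \<in> edges G"
  obtains x y where "e = {x, y}" "x \<noteq> y"
  using assms by (auto simp: weighted_graph_def card_2_iff)

section \<open>Counting edges around a triangle\<close>

text \<open>An edge from an outer vertex to the triangle has only one outer endpoint, so these edges
  are counted without overlap: with the triangle, at least \<open>3 + 2 * (n - 3)\<close> edges on
  \<open>n\<close> vertices, written here without subtraction.\<close>

lemma card_edges_ge_triangle:
  fixes G :: "('a::finite) wgraph"
  assumes tri: "{p, q} \<in> edges G" "{p, r} \<in> edges G" "{q, r} \<in> edges G"
    and d: "p \<noteq> q" "p \<noteq> r" "q \<noteq> r"
    and two: "\<And>x. x \<notin> {p, q, r} \<Longrightarrow> 2 \<le> card {t \<in> {p, q, r}. {x, t} \<in> edges G}"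
  shows "2 * CARD('a) \<le> card (edges G) + 3"
proof -
  define N where "N x = {t \<in> {p, q, r}. {x, t} \<in> edges G}" for x
  define E where "E x = (\<lambda>t. {x, t}) ` N x" for x
  let ?T = "{p, q, r}"
  have cardE: "2 \<le> card (E x)" if "x \<notin> ?T" for x
  proof -
    have "inj_on (\<lambda>t. {x, t}) (N x)"
      by (auto simp: inj_on_def doubleton_eq_iff)
    then show ?thesis
      using two[OF that] by (simp add: E_def card_image N_def)
  qed
  have "2 * card (- ?T) = (\<Sum>x\<in>- ?T. 2)"
    by simp
  also have "\<dots> \<le> (\<Sum>x\<in>- ?T. card (E x))"
    by (rule sum_mono) (use cardE in auto)
  also have "\<dots> = card (\<Union>x\<in>- ?T. E x)"
    by (rule card_UN_disjoint[symmetric]) (auto simp: E_def N_def doubleton_eq_iff)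
  finally have 1: "2 * card (- ?T) \<le> card (\<Union>x\<in>- ?T. E x)" .
  have "card {{p, q}, {p, r}, {q, r}} = 3"
    using d by (auto simp: doubleton_eq_iff card_insert_if)
  moreover have "{{p, q}, {p, r}, {q, r}} \<inter> (\<Union>x\<in>- ?T. E x) = {}"
    by (auto simp: E_def N_def doubleton_eq_iff)
  ultimately have "3 + card (\<Union>x\<in>- ?T. E x) = card ({{p, q}, {p, r}, {q, r}} \<union> (\<Union>x\<in>- ?T. E x))"
    by (subst card_Un_disjoint) auto
  also have "\<dots> \<le> card (edges G)"
    by (rule card_mono) (use tri in \<open>auto simp: E_def N_def\<close>)
  finally have "3 + 2 * card (- ?T) \<le> card (edges G)"
    using 1 by linarith
  \<comment> \<open>The second bound makes the truncated subtraction exact.\<close>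
  moreover have "card (- ?T) = CARD('a) - 3" "3 \<le> CARD('a)"
    using d card_mono[of UNIV ?T] by (simp_all add: Compl_eq_Diff_UNIV card_Diff_subset)
  ultimately show ?thesis
    by linarith
qed

section \<open>Recognising the theta graph\<close>

text \<open>The vertices \<open>p\<close> and \<open>q\<close> of degree three become the ends
  \<open>U\<close>, \<open>V\<close> of the chord; the nonadjacent \<open>r\<close>,
  \<open>x\<close> become \<open>X1\<close>, \<open>Z1\<close>.\<close>

lemma wgraph_iso_theta101I:
  fixes G :: "('a::finite) wgraph"
  assumes wg: "weighted_graph G" and univ: "UNIV = {p, q, r, x}"
    and d: "p \<noteq> q" "p \<noteq> r" "q \<noteq> r" "x \<notin> {p, q, r}"
    and E: "{p, q} \<in> edges G" "{p, r} \<in> edges G" "{q, r} \<in> edges G"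
      "{p, x} \<in> edges G" "{q, x} \<in> edges G" "{r, x} \<notin> edges G"
  shows "wgraph_iso G (theta101 (weight G {p, r}) (weight G {q, r}) (weight G {p, q})
    (weight G {p, x}) (weight G {q, x}))"
proof -
  define f where "f y = (if y = p then U else if y = q then V else if y = r then X1 else Z1)" for y
  have f: "f p = U" "f q = V" "f r = X1" "f x = Z1"
    using d by (auto simp: f_def)
  \<comment> \<open>Quantifiers over vertices become conjunctions, so the isomorphism conditions
    reduce to sixteen pairs.\<close>
  have all: "(\<forall>y. P y) \<longleftrightarrow> P p \<and> P q \<and> P r \<and> P x" for P
    by (metis UNIV_I univ insertE singletonD)
  have swap: "{q, p} = {p, q}" "{r, p} = {p, r}" "{r, q} = {q, r}"
    "{x, p} = {p, x}" "{x, q} = {q, x}" "{x, r} = {r, x}"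
    by blast+
  have loop: "{y} \<notin> edges G" for y
    using wg by (fastforce simp: weighted_graph_def)
  have "bij f"
  proof -
    have "inj f"
      unfolding inj_def all using f d by auto
    moreover have "y \<in> range f" for y
      using f by (cases y) (metis rangeI)+
    ultimately show ?thesis
      by (auto simp: bij_def)
  qed
  moreover have "\<forall>y z. {y, z} \<in> edges G \<longleftrightarrow>
      {f y, f z} \<in> edges (theta101 a1 a2 b1 c1 c2)" for a1 a2 b1 c1 c2
    unfolding all f
    by (simp only: E swap insert_absorb2 loop theta101_def wgraph.simps) (simp add: doubleton_eq_iff)
  moreover have "\<forall>y z. {y, z} \<in> edges G \<longrightarrow> weight G {y, z} =
      weight (theta101 (weight G {p, r}) (weight G {q, r}) (weight G {p, q})
        (weight G {p, x}) (weight G {q, x})) {f y, f z}"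
    unfolding all f
    by (simp only: E swap insert_absorb2 loop theta101_def wgraph.simps) (simp add: doubleton_eq_iff)
  ultimately show ?thesis
    unfolding wgraph_iso_def by blast
qed

section \<open>Characterisation of rank three\<close>

theorem theorem5p2:
  fixes G :: "('a::finite) wgraph"
  assumes "weighted_graph G" and "bicyclic G"
  shows "rank (adjacency_matrix G) = 3 \<longleftrightarrow>
    (\<exists>a1 a2 b1 c1 c2. a1 > 0 \<and> a2 > 0 \<and> b1 > 0 \<and> c1 > 0 \<and> c2 > 0 \<and>
       a2 * c1 = a1 * c2 \<and> wgraph_iso G (theta101 a1 a2 b1 c1 c2))"
    (is "_ \<longleftrightarrow> ?R")
proof
  let ?A = "adjacency_matrix G"
  note sym = adjacency_matrix_sym[of G]
  note diag = adjacency_matrix_diag[OF assms(1)]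
  note adj = adjacency_matrix_neq_0_iff[OF assms(1)]
  assume "rank ?A = 3"
  then obtain p q r where B: "three_row_basis ?A p q r"
    and tri: "?A $ p $ q \<noteq> 0" "?A $ p $ r \<noteq> 0" "?A $ q $ r \<noteq> 0"
    using rank_3_triangle sym diag by metis
  have d: "p \<noteq> q" "p \<noteq> r" "q \<noteq> r"
    using tri diag by metis+
  have E: "{p, q} \<in> edges G" "{p, r} \<in> edges G" "{q, r} \<in> edges G"
    using tri adj by auto
  have conn: "connected_graph G" and card: "card (edges G) = CARD('a) + 1"
    using assms(2) by (auto simp: bicyclic_def)
  \<comment> \<open>There is more than one vertex, so connectivity gives every vertex an
    edge.\<close>
  have row: "?A $ x \<noteq> 0" for x
  proof -
    obtain z where "{x, z} \<in> edges G"
      using connected_graph_has_neighbour[OF conn] d by metis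
    then show ?thesis
      using adj[of x z] by auto
  qed
  have tri': "?A $ q $ p \<noteq> 0" "?A $ r $ p \<noteq> 0" "?A $ r $ q \<noteq> 0"
    using tri sym by auto
  note swap = three_row_basis_swap
  \<comment> \<open>Each ordering of the triangle rules out that \<open>x\<close> misses one
    particular pair of its vertices; together, \<open>x\<close> misses at most one vertex.\<close>
  have two: "{x, q} \<in> edges G \<or> {x, r} \<in> edges G" "{x, p} \<in> edges G \<or> {x, r} \<in> edges G"
    "{x, p} \<in> edges G \<or> {x, q} \<in> edges G" for x
    using three_row_basis.two_neighbours[OF B tri row, of x]
      three_row_basis.two_neighbours[OF swap(1)[OF B] tri'(1) tri(3) tri(2) row, of x]
      three_row_basis.two_neighbours[OF swap(1)[OF swap(2)[OF B]] tri'(2,3) tri(1) row, of x]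
    unfolding adj by blast+
  have "2 \<le> card {t \<in> {p, q, r}. {x, t} \<in> edges G}" for x
  proof -
    obtain s t where "s \<noteq> t" "{s, t} \<subseteq> {t \<in> {p, q, r}. {x, t} \<in> edges G}"
      using two[of x] d by blast
    then show ?thesis
      using card_mono[of "{t \<in> {p, q, r}. {x, t} \<in> edges G}" "{s, t}"] by simp
  qed
  then have "2 * CARD('a) \<le> card (edges G) + 3"
    using card_edges_ge_triangle E d by blast
  \<comment> \<open>With \<open>n + 1\<close> edges the bound reads
    \<open>2 * n \<le> n + 4\<close>.\<close>
  then have le4: "CARD('a) \<le> 4"
    using card by linarith
  \<comment> \<open>Three vertices carry at most three edges, but four would be required.\<close>
  have "UNIV \<noteq> {p, q, r}"
  proof
    assume univ: "UNIV = {p, q, r}"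
    have "edges G \<subseteq> {{p, q}, {p, r}, {q, r}}"
    proof
      fix e assume "e \<in> edges G"
      then obtain y z where "e = {y, z}" "y \<noteq> z"
        using weighted_graph_edgeE[OF assms(1)] by blast
      moreover have "y \<in> {p, q, r}" "z \<in> {p, q, r}"
        using univ by blast+
      ultimately show "e \<in> {{p, q}, {p, r}, {q, r}}"
        by auto
    qed
    then have "card (edges G) \<le> card {{p, q}, {p, r}, {q, r}}"
      by (intro card_mono) auto
    also have "\<dots> \<le> 3"
      by (simp add: card_insert_if)
    also have "CARD('a) = 3"
      unfolding univ using d by simp
    ultimately show False
      using card by linarith
  qed
  then obtain x where x: "x \<notin> {p, q, r}"
    by blast
  have card4: "card {p, q, r, x} = 4"
    using d x by (auto simp: card_insert_if)
  then have univ: "UNIV = {p, q, r, x}"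
    using card_seteq[of UNIV "{p, q, r, x}"] le4 by simp
  then have "CARD('a) = 4"
    using card4 by simp
  then have "card (edges G) = 5"
    using card by simp
  \<comment> \<open>The six pairs on four vertices cannot all be among five edges.\<close>
  have missing: "{p, x} \<notin> edges G \<or> {q, x} \<notin> edges G \<or> {r, x} \<notin> edges G"
  proof (rule ccontr)
    assume "\<not> ?thesis"
    then have "{{p, q}, {p, r}, {q, r}, {p, x}, {q, x}, {r, x}} \<subseteq> edges G"
      using E by auto
    then have "card {{p, q}, {p, r}, {q, r}, {p, x}, {q, x}, {r, x}} \<le> card (edges G)"
      by (intro card_mono) auto
    moreover have "card {{p, q}, {p, r}, {q, r}, {p, x}, {q, x}, {r, x}} = 6"
      using d x by (auto simp: doubleton_eq_iff card_insert_if)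
    ultimately show False
      using \<open>card (edges G) = 5\<close> by simp
  qed
  \<comment> \<open>Generalised over \<open>p\<close>, \<open>q\<close>, \<open>r\<close> so that
    the triangle vertex not adjacent to \<open>x\<close> can always be named
    \<open>r\<close>.\<close>
  have result: ?R if B: "three_row_basis ?A p q r" and rx: "{r, x} \<notin> edges G"
    and univ: "UNIV = {p, q, r, x}" and d: "p \<noteq> q" "p \<noteq> r" "q \<noteq> r" "x \<notin> {p, q, r}"
    and E: "{p, q} \<in> edges G" "{p, r} \<in> edges G" "{q, r} \<in> edges G"
      "{p, x} \<in> edges G" "{q, x} \<in> edges G"
    for p q r
  proof -
    have "?A $ q $ r * ?A $ p $ x = ?A $ p $ r * ?A $ q $ x"
      by (rule three_row_basis.proportional_rows[OF B])
        (use E rx in \<open>auto simp: adj insert_commute\<close>, use adj[of x r] rx in \<open>auto simp: insert_commute\<close>)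
    then have "weight G {q, r} * weight G {p, x} = weight G {p, r} * weight G {q, x}"
      using E by (simp add: adjacency_matrix_nth)
    moreover have "weight G e > 0" if "e \<in> edges G" for e
      using assms(1) that by (simp add: weighted_graph_def)
    ultimately show ?R
      using wgraph_iso_theta101I[OF assms(1) univ d E rx] E by blast
  qed
  have comm: "{t, s} = {s, t}" for s t :: 'a
    by blast
  have univs: "UNIV = {p, r, q, x}" "UNIV = {q, r, p, x}" and xs: "x \<notin> {p, r, q}" "x \<notin> {q, r, p}"
    using univ x by blast+
  have E': "{r, q} \<in> edges G" "{r, p} \<in> edges G" "{q, p} \<in> edges G"
    using E comm by metis+
  have two': "{q, x} \<in> edges G \<or> {r, x} \<in> edges G" "{p, x} \<in> edges G \<or> {r, x} \<in> edges G"
    "{p, x} \<in> edges G \<or> {q, x} \<in> edges G"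
    using two[of x] unfolding comm[of x] by blast+
  \<comment> \<open>The other two edges at \<open>x\<close> are present by \<open>two'\<close>;
    swaps of the basis put the non-neighbour of \<open>x\<close> last.\<close>
  consider "{r, x} \<notin> edges G" | "{q, x} \<notin> edges G" | "{p, x} \<notin> edges G"
    using missing by blast
  then show ?R
  proof cases
    case 1
    then show ?R
      using result[OF B 1 univ d x E] two' by blast
  next
    case 2
    then show ?R
      using result[OF swap(2)[OF B] 2 univs(1) d(2,1) d(3)[symmetric] xs(1) E(2,1) E'(1)] two' by blast
  next
    case 3
    then show ?R
      using result[OF swap(2)[OF swap(1)[OF B]] 3 univs(2) d(3) d(1)[symmetric] d(2)[symmetric] xs(2)
        E(3) E'(3,2)] two' by blast
  qed
next
  let ?A = "adjacency_matrix G"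
  assume ?R
  then obtain a1 a2 b1 c1 c2 f where pos: "a1 > 0" "a2 > 0" "b1 > 0" "c1 > 0" "c2 > 0"
    and ratio: "a2 * c1 = a1 * c2" and f: "bij f"
    and E: "\<And>x y. {x, y} \<in> edges G \<longleftrightarrow> {f x, f y} \<in> edges (theta101 a1 a2 b1 c1 c2)"
    and W: "\<And>x y. {x, y} \<in> edges G \<Longrightarrow> weight G {x, y} = weight (theta101 a1 a2 b1 c1 c2) {f x, f y}"
    unfolding wgraph_iso_def by blast
  define g where "g = inv f"
  have fg: "f (g t) = t" for t
    using f by (simp add: g_def bij_is_surj surj_f_inv_f)
  \<comment> \<open>Pulling back along \<open>g\<close> expresses all entries by the explicit
    weights.\<close>
  have A: "?A $ g s $ g t = (if {s, t} \<in> edges (theta101 a1 a2 b1 c1 c2)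
      then weight (theta101 a1 a2 b1 c1 c2) {s, t} else 0)" for s t
    using E[of "g s" "g t"] W[of "g s" "g t"] by (simp add: adjacency_matrix_nth fg)
  show "rank ?A = 3"
  \<comment> \<open>With the chord ends in the roles of \<open>p\<close> and \<open>q\<close>, the
    ratio condition reads \<open>a2 * c1 = a1 * c2\<close>.\<close>
  proof (rule rank_3_if_proportional_rows[where p = "g U" and q = "g V" and r = "g X1" and x = "g Z1"])
    show "UNIV = {g U, g V, g X1, g Z1}"
    proof -
      have "y \<in> {g U, g V, g X1, g Z1}" for y
        using inv_f_f[OF bij_is_inj[OF f], of y] unfolding g_def by (cases "f y") auto
      then show ?thesis
        by blast
    qed
  qed (use pos ratio in \<open>simp_all add: A adjacency_matrix_sym adjacency_matrix_diag[OF assms(1)]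
    theta101_def doubleton_eq_iff\<close>)
qed

end
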